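(* Let $n\ge 1$ and let $f:\mathbb{R}^n\to\mathbb{R}^n$, $f(x)=x+h(x)$, be a $C^1$ map. Then the following conditions are equivalent: \begin{enumerate} \item $f$ is (unit upper) linearly triangularizable; \item the family of all matrices $\{J(h)(x)\}_{x\in\mathbb{R}^n}$ is strongly nilpotent; \item any composition product of (finitely many) maps from $\mathbb{R}^n$ to itself, in which $n$ or more of the factors equal $h$ and the remaining factors are translation-dilations, is a constant map. \end{enumerate}
   Context: $J(h)(x)$ is the Jacobian matrix of $h$ at $x$. A map $t=(t_1,\ldots,t_n):\mathbb{R}^n\to\mathbb{R}^n$ is (unit upper) triangular if, for each $i$, $t_i(x)-x_i$ depends only on those $x_j$ with $j>i$. A map $f$ is (unit upper) linearly triangularizable if there is an invertible linear map $S:\mathbb{R}^n\to\mathbb{R}^n$ such that $S^{-1}\circ f\circ S$ is (unit upper) triangular. A family of linear endomorphisms of a vector space (or of square matrices) is strongly nilpotent if there is a positive integer $r$ such that the product of any $r$ factors in the family (not necessarily distinct) is zero. A translation-dilation is a map $\tau:\mathbb{R}^n\to\mathbb{R}^n$ of the form $\tau(x)=a+\lambda x$ with $a\in\mathbb{R}^n$ and $\lambda\in\mathbb{R}$. *)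

theory Defs
  imports "HOL-Analysis.Analysis"
begin

definition C1_map :: "(real ^ 'n \<Rightarrow> real ^ 'm) \<Rightarrow> bool" where
  "C1_map f \<longleftrightarrow>
     (\<forall>x. f differentiable (at x)) \<and> continuous_on UNIV (\<lambda>x. jacobian f (at x))"

text \<open>The index type is an arbitrary finite linear order, i.e. a copy of \<open>{1, \<dots>, n}\<close>
  with \<open>n = CARD('n)\<close>; the order is needed only to state triangularity.\<close>

definition unit_upper_triangular ::
    "(real ^ ('n :: {finite, linorder}) \<Rightarrow> real ^ ('n :: _)) \<Rightarrow> bool" where
  "unit_upper_triangular t \<longleftrightarrow>
     (\<forall>i x y. (\<forall>j>i. x $ j = y $ j) \<longrightarrow> t x $ i - x $ i = t y $ i - y $ i)"

definition linearly_triangularizable ::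
    "(real ^ ('n :: {finite, linorder}) \<Rightarrow> real ^ ('n :: _)) \<Rightarrow> bool" where
  "linearly_triangularizable f \<longleftrightarrow>
     (\<exists>S :: real ^ ('n :: _) \<Rightarrow> real ^ ('n :: _).
        linear S \<and> bij S \<and> unit_upper_triangular (inv S \<circ> f \<circ> S))"

definition strongly_nilpotent :: "(real ^ 'n ^ 'n) set \<Rightarrow> bool" where
  "strongly_nilpotent F \<longleftrightarrow>
     (\<exists>r>0. \<forall>As. length As = r \<and> set As \<subseteq> F \<longrightarrow> foldr (**) As (mat 1) = 0)"

definition translation_dilation :: "(real ^ 'n \<Rightarrow> real ^ 'n) \<Rightarrow> bool" where
  "translation_dilation \<tau> \<longleftrightarrow> (\<exists>a c. \<forall>x. \<tau> x = a + c *\<^sub>R x)"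

end

theory Submission
  imports Defs
begin

text \<open>
  Write \<open>J x\<close> for the Jacobian matrix of \<open>h\<close> at \<open>x\<close>. The three conditions are proved equivalent
  as a cycle: triangularizability implies that the mixed compositions are constant, this implies
  strong nilpotence of the Jacobians, and strong nilpotence implies triangularizability.

  If \<open>S\<close> triangularizes \<open>f\<close>, then in the coordinates given by \<open>S\<close> the \<open>i\<close>-th component of \<open>h\<close>
  depends only on the components after \<open>i\<close>. Hence, each time \<open>h\<close> is applied, one more component,
  counted from the last one, becomes independent of the starting point, and a
  translation-dilation never undoes this, because it acts on each coordinate separately. After
  \<open>n\<close> applications of \<open>h\<close> all components are constant
  (\<open>constant_components_of_composition\<close>).

  Conversely, the product \<open>J x\<^sub>1 \<cdots> J x\<^sub>n\<close> is itself the derivative at \<open>0\<close> of an alternating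
  composition of \<open>h\<close> with translations, where the translations move the current value to the
  point at which the next Jacobian is wanted (\<open>jacobian_product_as_derivative\<close>). If the
  composition is constant, the product vanishes.

  Finally, for a strongly nilpotent family every proper subspace \<open>W\<close> has a vector outside \<open>W\<close>
  which the whole family maps into \<open>W\<close>: otherwise a vector outside \<open>W\<close> could be kept outside
  \<open>W\<close> by arbitrarily long products (\<open>strongly_nilpotent_vector_into_subspace\<close>). Choosing such
  vectors one after the other gives a basis in which all matrices of the family are strictly
  upper triangular (\<open>strongly_nilpotent_triangularizing_basis\<close>), and a map all of whose
  derivatives are strictly upper triangular is of triangular type, since its \<open>i\<close>-th component has
  zero derivative along any segment on which only the coordinates up to \<open>i\<close> vary
  (\<open>component_eq_if_derivative_strictly_triangular\<close>).
\<close>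

section \<open>From triangularity to constant compositions\<close>

text \<open>The number \<open>card {i<..}\<close> is the distance of \<open>i\<close> from the last index. The claim is an
  invariant for the induction on the list of factors: applying \<open>h\<close> makes one further coordinate
  constant, since that coordinate of the new value reads only coordinates which are constant
  already.\<close>
lemma constant_components_of_composition:
  fixes h :: "real ^ ('n :: {finite, linorder}) \<Rightarrow> real ^ ('n :: _)" and T :: "real ^ ('n :: _) \<Rightarrow> real ^ ('n :: _)"
  assumes T: "linear T"
    and tri: "\<And>i x y. (\<And>j. j > i \<Longrightarrow> T x $ j = T y $ j) \<Longrightarrow> T (h x) $ i = T (h y) $ i"
    and "\<forall>g\<in>set gs. g = h \<or> translation_dilation g"
    and "card {i<..} < count_list gs h"
  shows "T (foldr (\<circ>) gs id x) $ i = T (foldr (\<circ>) gs id y) $ i"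
  using assms(3,4)
proof (induction gs arbitrary: i)
  case (Cons g gs)
  let ?P = "foldr (\<circ>) gs id"
  show ?case
  proof (cases "g = h")
    case True
    have "T (?P x) $ j = T (?P y) $ j" if "j > i" for j
    proof (rule Cons.IH)
      have "card {j<..} < card {i<..}"
        using that by (intro psubset_card_mono) auto
      then show "card {j<..} < count_list gs h"
        using Cons.prems(2) True by simp
    qed (use Cons.prems in auto)
    then have "T (h (?P x)) $ i = T (h (?P y)) $ i"
      by (rule tri)
    moreover have "foldr (\<circ>) (g # gs) id z = h (?P z)" for z
      using True by simp
    ultimately show ?thesis
      by (simp only:)
  next
    case False
    then obtain a c where g: "\<And>z. g z = a + c *\<^sub>R z"
      using Cons.prems by (auto simp: translation_dilation_def)
    have "T (?P x) $ i = T (?P y) $ i"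
      by (rule Cons.IH) (use Cons.prems False in auto)
    then have "T (g (?P x)) $ i = T (g (?P y)) $ i"
      by (simp add: g linear_add[OF T] linear_scale[OF T])
    moreover have "foldr (\<circ>) (g # gs) id z = g (?P z)" for z
      by simp
    ultimately show ?thesis
      by (simp only:)
  qed
qed simp

lemma linearly_triangularizable_imp_constant_compositions:
  fixes h :: "real ^ ('n :: {finite, linorder}) \<Rightarrow> real ^ ('n :: _)"
  assumes "linearly_triangularizable (\<lambda>x. x + h x)"
    and gs: "\<forall>g\<in>set gs. g = h \<or> translation_dilation g" "CARD('n) \<le> count_list gs h"
  shows "foldr (\<circ>) gs id constant_on UNIV"
proof -
  obtain S :: "real ^ ('n :: _) \<Rightarrow> real ^ ('n :: _)" where S: "linear S" "bij S"
    and tri: "unit_upper_triangular (inv S \<circ> (\<lambda>x. x + h x) \<circ> S)"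
    using assms(1) by (auto simp: linearly_triangularizable_def)
  have T: "linear (inv S)"
    using S by (simp add: bij_is_inj bij_is_surj inj_linear_imp_inv_linear)
  have SI: "S (inv S x) = x" "inv S (S x) = x" for x
    using S(2) by (simp_all add: bij_is_surj surj_f_inv_f bij_is_inj)
  have "inv S (h x) $ i = inv S (h y) $ i"
    if "\<And>j. j > i \<Longrightarrow> inv S x $ j = inv S y $ j" for i x y
    using tri[unfolded unit_upper_triangular_def, rule_format, of i "inv S x" "inv S y"] that
    by (simp add: SI linear_add[OF T])
  then have "inv S (foldr (\<circ>) gs id x) $ i = inv S (foldr (\<circ>) gs id y) $ i" for i x y
  proof (rule constant_components_of_composition[OF T _ gs(1)])
    have "card {i<..} < CARD('n)"
      by (rule psubset_card_mono) auto
    then show "card {i<..} < count_list gs h"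
      using gs(2) by simp
  qed
  then have "inv S (foldr (\<circ>) gs id x) = inv S (foldr (\<circ>) gs id y)" for x y
    unfolding vec_eq_iff by blast
  then have "foldr (\<circ>) gs id x = foldr (\<circ>) gs id y" for x y
    by (rule injD[OF bij_is_inj[OF bij_imp_bij_inv[OF S(2)]]])
  then show ?thesis
    unfolding constant_on_def by blast
qed

section \<open>From constant compositions to strong nilpotence\<close>

text \<open>By the chain rule it is enough that each copy of \<open>h\<close> is evaluated at the prescribed
  point; a translation achieves this without changing the derivative.\<close>
lemma jacobian_product_as_derivative:
  fixes h :: "real ^ 'n \<Rightarrow> real ^ 'n"
  assumes h: "\<And>x. h differentiable (at x)"
  shows "\<exists>gs. (\<forall>g\<in>set gs. g = h \<or> translation_dilation g) \<and> length xs \<le> count_list gs h \<and>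
    (foldr (\<circ>) gs id has_derivative
      (*v) (foldr (**) (map (\<lambda>x. jacobian h (at x)) xs) (mat 1))) (at 0)"
proof (induction xs)
  case Nil
  have "(*v) (mat 1 :: real ^ 'n ^ 'n) = id"
    by (simp add: fun_eq_iff)
  then show ?case
    by (intro exI[of _ "[]"]) simp
next
  case (Cons x xs)
  let ?A = "foldr (**) (map (\<lambda>x. jacobian h (at x)) xs) (mat 1)"
  obtain gs where gs: "\<forall>g\<in>set gs. g = h \<or> translation_dilation g" "length xs \<le> count_list gs h"
    and der: "(foldr (\<circ>) gs id has_derivative (*v) ?A) (at 0)"
    using Cons.IH by blast
  let ?P = "foldr (\<circ>) gs id"
  define \<tau> where "\<tau> y = (x - ?P 0) + y" for y
  have "translation_dilation \<tau>"
    unfolding translation_dilation_def \<tau>_def by (metis scaleR_one)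
  have "(foldr (\<circ>) (h # \<tau> # gs) id has_derivative
      (*v) (foldr (**) (map (\<lambda>x. jacobian h (at x)) (x # xs)) (mat 1))) (at 0)"
  proof -
    have 1: "((\<lambda>y. \<tau> (?P y)) has_derivative (*v) ?A) (at 0)"
      unfolding \<tau>_def using has_derivative_add[OF has_derivative_const der] by simp
    have "(h has_derivative (*v) (jacobian h (at x))) (at (\<tau> (?P 0)))"
      using h[of x] jacobian_works by (auto simp: \<tau>_def)
    from has_derivative_compose[OF 1 this]
    have "((\<lambda>y. h (\<tau> (?P y))) has_derivative (\<lambda>v. jacobian h (at x) *v (?A *v v))) (at 0)" .
    moreover have "foldr (\<circ>) (h # \<tau> # gs) id = (\<lambda>y. h (\<tau> (?P y)))"
      by (simp add: fun_eq_iff)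
    ultimately show ?thesis
      by (simp only: matrix_vector_mul_assoc list.map foldr.simps o_apply)
  qed
  moreover have "\<forall>g\<in>set (h # \<tau> # gs). g = h \<or> translation_dilation g"
    "length (x # xs) \<le> count_list (h # \<tau> # gs) h"
    using gs \<open>translation_dilation \<tau>\<close> by auto
  ultimately show ?case
    by blast
qed

lemma constant_compositions_imp_strongly_nilpotent:
  fixes h :: "real ^ 'n \<Rightarrow> real ^ 'n"
  assumes h: "\<And>x. h differentiable (at x)"
    and const: "\<And>gs. \<forall>g\<in>set gs. g = h \<or> translation_dilation g \<Longrightarrow> CARD('n) \<le> count_list gs h
      \<Longrightarrow> foldr (\<circ>) gs id constant_on UNIV"
  shows "strongly_nilpotent (range (\<lambda>x. jacobian h (at x)))"
  unfolding strongly_nilpotent_def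
proof (intro exI[of _ "CARD('n)"] conjI allI impI)
  fix As assume As: "length As = CARD('n) \<and> set As \<subseteq> range (\<lambda>x. jacobian h (at x))"
  then have "\<exists>xs. As = map (\<lambda>x. jacobian h (at x)) xs"
    unfolding ex_map_conv by blast
  then obtain xs where xs: "As = map (\<lambda>x. jacobian h (at x)) xs" by blast
  obtain gs where gs: "\<forall>g\<in>set gs. g = h \<or> translation_dilation g" "length xs \<le> count_list gs h"
    and der: "(foldr (\<circ>) gs id has_derivative (*v) (foldr (**) As (mat 1))) (at 0)"
    using jacobian_product_as_derivative[OF h, of xs] xs by blast
  from const[OF gs(1)] gs(2) As xs obtain c where "foldr (\<circ>) gs id = (\<lambda>x. c)"
    by (auto simp: constant_on_def)
  with der have "(*v) (foldr (**) As (mat 1)) = (\<lambda>v. 0)"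
    by (metis has_derivative_const has_derivative_unique)
  then show "foldr (**) As (mat 1) = 0"
    by (metis matrix_eq matrix_vector_mult_0)
qed simp

section \<open>From strong nilpotence to triangularity\<close>

text \<open>If no such vector existed, each vector outside \<open>W\<close> would be moved by some member of the
  family to a vector outside \<open>W\<close>. Iterating gives products of every length which move a vector
  outside \<open>W\<close>, whereas long products are zero.\<close>
lemma strongly_nilpotent_vector_into_subspace:
  fixes F :: "(real ^ 'n ^ 'n) set"
  assumes F: "strongly_nilpotent F" and W: "subspace W" "W \<noteq> UNIV"
  shows "\<exists>v. v \<notin> W \<and> (\<forall>A\<in>F. A *v v \<in> W)"
proof (rule ccontr)
  assume "\<not> ?thesis"
  then have step: "\<exists>A\<in>F. A *v v \<notin> W" if "v \<notin> W" for v
    using that by blast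
  obtain v where v: "v \<notin> W" using W by blast
  have long: "\<exists>As. length As = r \<and> set As \<subseteq> F \<and> foldr (**) As (mat 1) *v v \<notin> W" for r
  proof (induction r)
    case 0
    show ?case using v by auto
  next
    case (Suc r)
    then obtain As A where "length As = r" "set As \<subseteq> F" "A \<in> F"
      "A *v (foldr (**) As (mat 1) *v v) \<notin> W"
      using step by metis
    then show ?case
      by (intro exI[of _ "A # As"]) (auto simp: matrix_vector_mul_assoc)
  qed
  obtain r where "\<And>As. length As = r \<Longrightarrow> set As \<subseteq> F \<Longrightarrow> foldr (**) As (mat 1) = 0"
    using F by (auto simp: strongly_nilpotent_def)
  with long[of r] subspace_0[OF W(1)] show False
    by (metis matrix_vector_mult_0)
qed

lemma inj_linear_combination_if_successively_independent:
  fixes b :: "'n :: {finite, linorder} \<Rightarrow> real ^ 'm"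
  assumes b: "\<And>i. b i \<notin> span (b ` {..<i})"
  shows "inj (\<lambda>x :: real ^ ('n :: _). \<Sum>i\<in>UNIV. x $ i *\<^sub>R b i)"
proof -
  let ?S = "\<lambda>x :: real ^ ('n :: _). \<Sum>i\<in>UNIV. x $ i *\<^sub>R b i"
  have "linear ?S"
    by (rule linearI) (simp_all add: scaleR_add_left sum.distrib scaleR_sum_right)
  moreover have "x = 0" if x: "?S x = 0" for x :: "real ^ ('n :: _)"
  proof (rule ccontr)
    \<comment> \<open>The last nonzero coefficient would express its vector by the earlier ones.\<close>
    assume "x \<noteq> 0"
    then have ne: "{i. x $ i \<noteq> 0} \<noteq> {}" by (auto simp: vec_eq_iff)
    define m where "m = Max {i. x $ i \<noteq> 0}"
    have m: "x $ m \<noteq> 0"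
      using Max_in[OF _ ne] by (simp add: m_def)
    have "i \<le> m" if "x $ i \<noteq> 0" for i
      using that by (simp add: m_def)
    then have above: "x $ i = 0" if "i > m" for i
      using that by (meson leD)
    have "?S x = (\<Sum>i\<in>{..m}. x $ i *\<^sub>R b i)"
      by (rule sum.mono_neutral_right) (auto simp: above)
    also have "{..m} = insert m {..<m}" by auto
    finally have "x $ m *\<^sub>R b m = - (\<Sum>i<m. x $ i *\<^sub>R b i)"
      using x by (simp add: eq_neg_iff_add_eq_0)
    also have "\<dots> \<in> span (b ` {..<m})"
      by (intro span_neg span_sum span_scale span_base) auto
    finally have "(1 / x $ m) *\<^sub>R (x $ m *\<^sub>R b m) \<in> span (b ` {..<m})"
      by (rule span_scale)
    then show False using m b[of m] by simp
  qed
  ultimately show ?thesis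
    by (simp add: linear_injective_0)
qed

text \<open>The conclusion says that the matrix of each \<open>A\<close> with respect to the basis \<open>S e\<^sub>i\<close> is strictly
  upper triangular, in the form in which it is applied to directional derivatives.\<close>
lemma strongly_nilpotent_triangularizing_basis:
  fixes F :: "(real ^ ('n :: {finite, linorder}) ^ ('n :: _)) set"
  assumes F: "strongly_nilpotent F"
  shows "\<exists>S :: real ^ ('n :: _) \<Rightarrow> real ^ ('n :: _). linear S \<and> bij S \<and>
    (\<forall>A\<in>F. \<forall>i v. (\<forall>j>i. v $ j = 0) \<longrightarrow> inv S (A *v S v) $ i = 0)"
proof -
  \<comment> \<open>The vector \<open>b i\<close> is chosen after all \<open>b j\<close> with \<open>j < i\<close>. Their span is a proper subspace
    for dimension reasons, so the preceding existence result applies to it.\<close>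
  let ?Q = "\<lambda>b i v. v \<notin> span (b ` {..<i}) \<and> (\<forall>A\<in>F. A *v v \<in> span (b ` {..<i}))"
  have "\<exists>b :: 'n \<Rightarrow> real ^ ('n :: _). \<forall>i. ?Q b i (b i)"
  proof (rule dependent_wf_choice[of "{(i, j). i < j}"])
    show "wf {(i, j :: 'n). i < j}"
      by (rule wf_subset[OF wf_measure[of "\<lambda>i. card {..<i}"]]) (auto intro!: psubset_card_mono)
  next
    fix b c :: "'n \<Rightarrow> real ^ ('n :: _)" and i v
    assume "\<And>j. (j, i) \<in> {(i, j). i < j} \<Longrightarrow> b j = c j"
    then have "b ` {..<i} = c ` {..<i}" by (auto intro!: image_cong)
    then show "?Q b i v = ?Q c i v" by simp
  next
    fix i and b :: "'n \<Rightarrow> real ^ ('n :: _)"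
    have "dim (span (b ` {..<i})) \<le> card (b ` {..<i})"
      by (simp add: dim_le_card')
    also have "\<dots> \<le> card {..<i}"
      by (rule card_image_le) simp
    also have "\<dots> < CARD('n)"
      by (rule psubset_card_mono) auto
    finally have "span (b ` {..<i}) \<noteq> UNIV"
      by (metis dim_UNIV DIM_cart DIM_real mult.right_neutral less_irrefl)
    then show "\<exists>v. ?Q b i v"
      by (intro strongly_nilpotent_vector_into_subspace[OF F] subspace_span)
  qed
  then obtain b :: "'n \<Rightarrow> real ^ ('n :: _)" where b: "\<And>i. b i \<notin> span (b ` {..<i})"
    and Fb: "\<And>i A. A \<in> F \<Longrightarrow> A *v b i \<in> span (b ` {..<i})"
    by blast
  define S where "S x = (\<Sum>i\<in>UNIV. x $ i *\<^sub>R b i)" for x :: "real ^ ('n :: _)"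
  have lin: "linear S"
    unfolding S_def
    by (rule linearI) (simp_all add: scaleR_add_left sum.distrib scaleR_sum_right)
  have "inj S"
    unfolding S_def by (rule inj_linear_combination_if_successively_independent[OF b])
  then have bij: "bij S"
    using lin by (simp add: bij_def linear_injective_imp_surjective)
  have "inv S (A *v S v) $ i = 0" if A: "A \<in> F" and v: "\<forall>j>i. v $ j = 0" for A i v
  proof -
    let ?U = "{w :: real ^ ('n :: _). \<forall>j\<ge>i. w $ j = 0}"
    have "S (axis j 1) = b j" for j
      unfolding S_def by (subst sum.remove[of _ j]) (auto simp: axis_def intro!: sum.neutral)
    then have "b ` {..<i} \<subseteq> S ` ?U"
      by (force simp: axis_def intro!: image_eqI[of _ S "axis _ 1"])
    moreover have "subspace (S ` ?U)"
      by (rule linear_subspace_image[OF lin]) (auto simp: subspace_def)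
    ultimately have U: "span (b ` {..<i}) \<subseteq> S ` ?U"
      by (rule span_minimal)
    have "A *v S v = (\<Sum>j\<in>UNIV. v $ j *\<^sub>R (A *v b j))"
      unfolding S_def by (simp add: linear_sum[OF matrix_vector_mul_linear] matrix_vector_mult_scaleR)
    also have "\<dots> \<in> span (b ` {..<i})"
    proof (rule span_sum)
      fix j
      show "v $ j *\<^sub>R (A *v b j) \<in> span (b ` {..<i})"
      proof (cases "j > i")
        case True
        then show ?thesis using v by (simp add: span_0)
      next
        case False
        then have "span (b ` {..<j}) \<subseteq> span (b ` {..<i})"
          by (intro span_mono image_mono) auto
        then show ?thesis using Fb[OF A, of j] by (auto intro: span_scale)
      qed
    qed
    finally obtain w where "A *v S v = S w" "w \<in> ?U"
      using U by blast
    then show ?thesis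
      using \<open>inj S\<close> by simp
  qed
  then show ?thesis
    using lin bij by blast
qed

lemma component_eq_if_derivative_strictly_triangular:
  fixes g :: "real ^ ('n :: {finite, linorder}) \<Rightarrow> real ^ 'm"
  assumes der: "\<And>x. (g has_derivative g' x) (at x)"
    and tri: "\<And>x v. (\<forall>j>i. v $ j = 0) \<Longrightarrow> g' x v $ k = 0"
    and xy: "\<forall>j>i. x $ j = y $ j"
  shows "g x $ k = g y $ k"
proof -
  let ?p = "\<lambda>s :: real. x + s *\<^sub>R (y - x)"
  have "((\<lambda>s. g (?p s) $ k) has_derivative (\<lambda>s. 0)) (at s)" for s
  proof -
    have "(?p has_derivative (\<lambda>s. s *\<^sub>R (y - x))) (at s)"
      by (auto intro!: derivative_eq_intros)
    from has_derivative_compose[OF this der]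
    have "((\<lambda>s. g (?p s) $ k) has_derivative (\<lambda>t. g' (?p s) (t *\<^sub>R (y - x)) $ k)) (at s)"
      by (rule bounded_linear.has_derivative[OF bounded_linear_vec_nth])
    moreover have "g' (?p s) (t *\<^sub>R (y - x)) $ k = 0" for t
      by (rule tri) (use xy in simp)
    ultimately show ?thesis by simp
  qed
  then obtain c where "\<And>s. g (?p s) $ k = c"
    using has_derivative_zero_constant[of UNIV "\<lambda>s. g (?p s) $ k"] by auto
  from this[of 0] this[of 1] show ?thesis by simp
qed

lemma strongly_nilpotent_imp_linearly_triangularizable:
  fixes h :: "real ^ ('n :: {finite, linorder}) \<Rightarrow> real ^ ('n :: _)"
  assumes h: "\<And>x. h differentiable (at x)"
    and "strongly_nilpotent (range (\<lambda>x. jacobian h (at x)))"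
  shows "linearly_triangularizable (\<lambda>x. x + h x)"
proof -
  obtain S :: "real ^ ('n :: _) \<Rightarrow> real ^ ('n :: _)" where S: "linear S" "bij S"
    and tri: "\<And>x i v. (\<forall>j>i. v $ j = 0) \<Longrightarrow> inv S (jacobian h (at x) *v S v) $ i = 0"
    using strongly_nilpotent_triangularizing_basis[OF assms(2)] by blast
  have T: "linear (inv S)"
    using S by (simp add: bij_is_inj bij_is_surj inj_linear_imp_inv_linear)
  have SI: "inv S (S x) = x" for x
    using S(2) by (simp add: bij_is_inj)
  have der: "((\<lambda>x. inv S (h (S x))) has_derivative
      (\<lambda>v. inv S (jacobian h (at (S x)) *v S v))) (at x)" for x
  proof -
    have "(h has_derivative (*v) (jacobian h (at (S x)))) (at (S x))"
      using h[of "S x"] jacobian_works by auto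
    from has_derivative_compose[OF linear_imp_has_derivative[OF S(1)] this]
    show ?thesis
      by (rule bounded_linear.has_derivative[OF T[THEN linear_linear[THEN iffD2]]])
  qed
  have "unit_upper_triangular (inv S \<circ> (\<lambda>x. x + h x) \<circ> S)"
    unfolding unit_upper_triangular_def
  proof (intro allI impI)
    fix i and x y :: "real ^ ('n :: _)"
    assume "\<forall>j>i. x $ j = y $ j"
    from component_eq_if_derivative_strictly_triangular[OF der tri this]
    have "inv S (h (S x)) $ i = inv S (h (S y)) $ i" by simp
    then show "(inv S \<circ> (\<lambda>x. x + h x) \<circ> S) x $ i - x $ i = (inv S \<circ> (\<lambda>x. x + h x) \<circ> S) y $ i - y $ i"
      by (simp add: linear_add[OF T] SI)
  qed
  then show ?thesis
    using S by (auto simp: linearly_triangularizable_def)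
qed

section \<open>The equivalence\<close>

theorem theorem8p1:
  fixes f h :: "real ^ ('n :: {finite, linorder}) \<Rightarrow> real ^ ('n :: _)"
  assumes "\<And>x. f x = x + h x"
    and "C1_map f"
  shows "(linearly_triangularizable f \<longleftrightarrow>
            strongly_nilpotent (range (\<lambda>x. jacobian h (at x)))) \<and>
         (strongly_nilpotent (range (\<lambda>x. jacobian h (at x))) \<longleftrightarrow>
            (\<forall>gs. (\<forall>g\<in>set gs. g = h \<or> translation_dilation g) \<and> CARD('n) \<le> count_list gs h
                \<longrightarrow> foldr (\<circ>) gs id constant_on UNIV))"
proof -
  have f: "f = (\<lambda>x. x + h x)" using assms(1) by blast
  have "h = (\<lambda>x. f x - x)" using assms(1) by (simp add: fun_eq_iff)
  then have "h differentiable (at x)" for x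
    using assms(2) by (auto simp: C1_map_def intro!: derivative_intros)
  then show ?thesis
    unfolding f
    using linearly_triangularizable_imp_constant_compositions[of h]
      constant_compositions_imp_strongly_nilpotent[of h]
      strongly_nilpotent_imp_linearly_triangularizable[of h]
    by blast
qed

end
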